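(* Let $t\geq 3$ be a fixed integer, let $d_t=\binom t2$, and define \[ A_t^{\mathrm S}=\max_{1\leq q\leq t-1}\frac{q}{q+1}\left(t-\frac{q+1}{2}\right)^2, \] the maximum being over integers $q$. Then \[ \limsup_{U\to\infty}\frac{P_t(U)}U\leq \min\left\{1,\frac{d_t}{A_t^{\mathrm S}}\right\}. \] Equivalently, \[ \liminf_{U\to\infty}\lambda_t(U)\geq c_t^{\mathrm S},\qquad c_t^{\mathrm S}=\max\left\{0,1-\frac{d_t}{A_t^{\mathrm S}}\right\}. \]
   Context: For a finite set $A=\{a_1<\cdots<a_t\}\subset\mathbb Z$, write $\Delta^+(A)=\{a_j-a_i:1\leq i<j\leq t\}$. The set $A$ is a $t$-mark Golomb ruler if all these positive differences $a_j-a_i$ ($1\le i<j\le t$) are distinct, i.e. $|\Delta^+(A)|=\binom t2$. For an integer $U\geq 1$, $P_t(U)$ denotes the maximum of $\left|\bigcup_{i=1}^{b}\Delta^+(A_i)\right|$ over all finite families $A_1,\dots,A_b$ (including the empty family) of $t$-mark Golomb rulers for which the sets $\Delta^+(A_i)$ are pairwise disjoint and contained in $[1,U]$, where $[1,U]$ is the set of integers from $1$ to $U$. The uncovered proportion is $\lambda_t(U)=1-P_t(U)/U$. *)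

theory Defs
  imports "HOL-Analysis.Analysis"
begin

definition pos_diffs :: "int set \<Rightarrow> int set" where
  "pos_diffs A = {y - x | x y. x \<in> A \<and> y \<in> A \<and> x < y}"

definition golomb_ruler :: "nat \<Rightarrow> int set \<Rightarrow> bool" where
  "golomb_ruler t A \<longleftrightarrow> finite A \<and> card A = t \<and>
     inj_on (\<lambda>(x, y). y - x) {(x, y). x \<in> A \<and> y \<in> A \<and> x < y}"

lemma card_increasing_pairs:
  fixes A :: "int set"
  assumes "finite A"
  shows "card {(x, y). x \<in> A \<and> y \<in> A \<and> x < y} = card A choose 2"
proof -
  let ?P = "{(x, y). x \<in> A \<and> y \<in> A \<and> x < y}"
  have "bij_betw (\<lambda>(x, y). {x, y}) ?P {B. B \<subseteq> A \<and> card B = 2}"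
    unfolding bij_betw_def
  proof
    show "inj_on (\<lambda>(x, y). {x, y}) ?P"
      by (auto simp: inj_on_def doubleton_eq_iff)
    show "(\<lambda>(x, y). {x, y}) ` ?P = {B. B \<subseteq> A \<and> card B = 2}"
    proof (intro equalityI subsetI)
      fix B assume "B \<in> {B. B \<subseteq> A \<and> card B = 2}"
      then obtain x y where xy: "B = {x, y}" "x \<noteq> y" "x \<in> A" "y \<in> A"
        by (auto simp: card_2_iff)
      show "B \<in> (\<lambda>(x, y). {x, y}) ` ?P"
      proof (cases "x < y")
        case True
        then show ?thesis using xy by (intro image_eqI[of _ _ "(x, y)"]) auto
      next
        case False
        then show ?thesis using xy by (intro image_eqI[of _ _ "(y, x)"]) auto
      qed
    qed auto
  qed
  then show ?thesis
    using n_subsets[OF assms, of 2] by (simp add: bij_betw_same_card)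
qed

lemma golomb_ruler_iff_card:
  "golomb_ruler t A \<longleftrightarrow> finite A \<and> card A = t \<and> card (pos_diffs A) = t choose 2"
proof (cases "finite A")
  case True
  let ?P = "{(x, y). x \<in> A \<and> y \<in> A \<and> x < y}"
  have img: "pos_diffs A = (\<lambda>(x, y). y - x) ` ?P"
    by (auto simp: pos_diffs_def image_iff)
  have "finite ?P"
    by (rule finite_subset[of _ "A \<times> A"]) (use True in auto)
  then have "inj_on (\<lambda>(x, y). y - x) ?P \<longleftrightarrow> card (pos_diffs A) = card ?P"
    unfolding img by (auto intro: eq_card_imp_inj_on card_image)
  then show ?thesis
    unfolding golomb_ruler_def card_increasing_pairs[OF True] using True by auto
qed (simp add: golomb_ruler_def)

text \<open>The family is \<open>A 1, \<dots>, A b\<close>; the values of \<open>A\<close> outside \<open>{1..b}\<close> are irrelevant,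
  and \<open>b = 0\<close> is the empty family.\<close>
definition ruler_packing :: "nat \<Rightarrow> nat \<Rightarrow> nat \<Rightarrow> (nat \<Rightarrow> int set) \<Rightarrow> bool" where
  "ruler_packing t U b A \<longleftrightarrow>
     (\<forall>i\<in>{1..b}. golomb_ruler t (A i) \<and> pos_diffs (A i) \<subseteq> {1..int U}) \<and>
     disjoint_family_on (\<lambda>i. pos_diffs (A i)) {1..b}"

definition max_coverage :: "nat \<Rightarrow> nat \<Rightarrow> nat" where
  "max_coverage t U = Max {card (\<Union>i\<in>{1..b}. pos_diffs (A i)) | b A. ruler_packing t U b A}"

text \<open>The set in \<open>max_coverage\<close> is finite and nonempty, so its \<open>Max\<close> is a genuine maximum.\<close>
lemma max_coverage_set:
  "finite {card (\<Union>i\<in>{1..b}. pos_diffs (A i)) | b A. ruler_packing t U b A}"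
  "{card (\<Union>i\<in>{1..b}. pos_diffs (A i)) | b A. ruler_packing t U b A} \<noteq> {}"
proof -
  let ?S = "{card (\<Union>i\<in>{1..b}. pos_diffs (A i)) | b A. ruler_packing t U b A}"
  have "?S \<subseteq> {..U}"
  proof
    fix n assume "n \<in> ?S"
    then obtain b A where n: "n = card (\<Union>i\<in>{1..b}. pos_diffs (A i))"
      and A: "ruler_packing t U b A"
      by blast
    have "(\<Union>i\<in>{1..b}. pos_diffs (A i)) \<subseteq> {1..int U}"
      using A unfolding ruler_packing_def by blast
    from card_mono[OF _ this] show "n \<in> {..U}"
      by (simp add: n)
  qed
  then show "finite ?S"
    by (rule finite_subset) simp
  have "ruler_packing t U 0 (\<lambda>_. {})"
    by (simp add: ruler_packing_def disjoint_family_on_def)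
  then show "?S \<noteq> {}"
    by blast
qed

definition uncovered_proportion :: "nat \<Rightarrow> nat \<Rightarrow> real" where
  "uncovered_proportion t U = 1 - real (max_coverage t U) / real U"

definition A_S :: "nat \<Rightarrow> real" where
  "A_S t = Max ((\<lambda>q. real q / (real q + 1) * (real t - (real q + 1) / 2)\<^sup>2) ` {1..t - 1})"

definition c_S :: "nat \<Rightarrow> real" where
  "c_S t = max 0 (1 - real (t choose 2) / A_S t)"

end

theory Submission
  imports Defs
begin

text \<open>For \<open>q < t\<close>, a \<open>t\<close>-mark ruler \<open>a 0 < \<dots> < a (t - 1)\<close> has
  \<open>N = q (t - (q + 1) / 2)\<close> differences \<open>a (j + k) - a j\<close> of order \<open>k \<le> q\<close>. For fixed \<open>k\<close> they
  telescope to a sum of \<open>k\<close> differences, each at most \<open>U\<close>, so together they add up to at most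
  \<open>U q (q + 1) / 2\<close>. In a packing of \<open>b\<close> rulers these are \<open>b N\<close> distinct positive integers, whose
  sum is at least \<open>(b N)\<^sup>2 / 2\<close>. Hence \<open>b N\<^sup>2 \<le> U q (q + 1)\<close>, that is
  \<open>b q / (q + 1) (t - (q + 1) / 2)\<^sup>2 \<le> U\<close>, while the packing covers \<open>b (t choose 2)\<close> integers.\<close>

text \<open>The largest of n distinct positive integers is at least n, so inserting them in
  increasing order gives a sum of at least 1 + ... + n. Dropping the linear term leaves a pure
  square.\<close>

lemma square_card_le_sum_pos_ints:
  fixes S :: "int set"
  assumes "finite S" "\<And>x. x \<in> S \<Longrightarrow> x > 0"
  shows "(int (card S))\<^sup>2 \<le> 2 * \<Sum>S"
proof -
  have "int (card S) * (int (card S) + 1) \<le> 2 * \<Sum>S"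
    using assms
  proof (induction rule: finite_linorder_max_induct)
    case empty
    then show ?case by simp
  next
    case (insert m S)
    have "insert m S \<subseteq> {1..m}"
      using insert.hyps insert.prems by force
    from card_mono[OF _ this] have "card (insert m S) \<le> nat m"
      by simp
    moreover have "m \<notin> S"
      using insert.hyps by blast
    moreover have "0 < m"
      using insert.prems by blast
    ultimately have "int (card S) + 1 \<le> m"
      using insert.hyps by simp
    with insert \<open>m \<notin> S\<close> show ?case
      by (simp add: algebra_simps)
  qed
  then show ?thesis
    by (simp add: power2_eq_square algebra_simps)
qed

text \<open>Writing S m for the sum of the first m values, both sides equal S t - S k - S (t - k),
  which is symmetric under exchanging k and t - k. The right side has only k terms, so bounding each
  by U costs k U instead of (t - k) U.\<close>

lemma sum_shifted_differences:
  fixes a :: "nat \<Rightarrow> 'a::ab_group_add"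
  assumes "k \<le> t"
  shows "(\<Sum>j<t - k. a (j + k) - a j) = (\<Sum>j<k. a (j + (t - k)) - a j)"
proof -
  have shift: "(\<Sum>j<t - m. a (j + m)) = sum a {..<t} - sum a {..<m}" if "m \<le> t" for m
    using sum.atLeastLessThan_concat[of 0 m t a] sum.shift_bounds_nat_ivl[of a 0 m "t - m"] that
    by (simp add: lessThan_atLeast0 algebra_simps)
  show ?thesis
    using shift[of k] shift[of "t - k"] assms by (simp add: sum_subtractf)
qed

lemma golomb_ruler_small_order_differences:
  assumes "golomb_ruler t A" "pos_diffs A \<subseteq> {1..int U}" "q < t"
  obtains D where "D \<subseteq> pos_diffs A" "card D = (\<Sum>k=1..q. t - k)"
    "2 * \<Sum>D \<le> int (U * q * (q + 1))"
proof -
  define a where "a j = sorted_list_of_set A ! j" for j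
  have A: "finite A" "card A = t"
    and inj: "inj_on (\<lambda>(x, y). y - x) {(x, y). x \<in> A \<and> y \<in> A \<and> x < y}"
    using assms(1) by (auto simp: golomb_ruler_def)
  have mem: "a j \<in> A" if "j < t" for j
    using nth_mem[of j "sorted_list_of_set A"] that A by (simp add: a_def)
  have less: "a i < a j" if "i < j" "j < t" for i j
    using sorted_wrt_nth_less[OF strict_sorted_list_of_set[of A]] that A by (simp add: a_def)
  have diff: "a j - a i \<in> pos_diffs A" if "i < j" "j < t" for i j
    using mem[of i] mem[of j] less[OF that] that by (auto simp: pos_diffs_def)
  have a_inj: "i = j" if "a i = a j" "i < t" "j < t" for i j
    using less[of i j] less[of j i] that by (cases i j rule: linorder_cases) auto
  \<comment> \<open>In a pair (k, j), k is the order and \<open>a j\<close> the left mark; the right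
    mark \<open>a (j + k)\<close> exists exactly when j < t - k.\<close>
  define I where "I = (SIGMA k:{1..q}. {..<t - k})"
  define f where "f = (\<lambda>(k, j). a (j + k) - a j)"
  have f_inj: "inj_on f I"
  proof (rule inj_onI)
    fix x y assume x: "x \<in> I" and y: "y \<in> I" and eq: "f x = f y"
    obtain k j l i where xy: "x = (k, j)" "y = (l, i)"
      by (cases x, cases y)
    have b: "1 \<le> k" "j + k < t" "1 \<le> l" "i + l < t"
      using x y by (auto simp: xy I_def)
    \<comment> \<open>The ruler property identifies the two pairs of marks, and injectivity of
      \<open>a\<close> then recovers the indices.\<close>
    have "(a j, a (j + k)) = (a i, a (i + l))"
      by (rule inj_onD[OF inj]) (use eq b in \<open>auto simp: xy f_def intro!: mem less\<close>)
    then have "j = i" "j + k = i + l"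
      using b by (auto dest!: a_inj)
    then show "x = y"
      by (simp add: xy)
  qed
  have order: "(\<Sum>j<t - k. a (j + k) - a j) \<le> int U * int k" if "k \<in> {1..q}" for k
  proof -
    have k: "k < t"
      using that assms(3) by simp
    have "(\<Sum>j<t - k. a (j + k) - a j) = (\<Sum>j<k. a (j + (t - k)) - a j)"
      using k by (intro sum_shifted_differences) simp
    also have "\<dots> \<le> (\<Sum>j<k. int U)"
    proof (rule sum_mono)
      fix j assume "j \<in> {..<k}"
      then have "a (j + (t - k)) - a j \<in> pos_diffs A"
        using k by (intro diff) auto
      then show "a (j + (t - k)) - a j \<le> int U"
        using assms(2) by auto
    qed
    finally show ?thesis
      by (simp add: mult.commute)
  qed
  show thesis
  proof
    show "f ` I \<subseteq> pos_diffs A"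
      by (auto simp: f_def I_def intro!: diff)
    show "card (f ` I) = (\<Sum>k=1..q. t - k)"
      using card_image[OF f_inj] by (simp add: I_def)
    have "\<Sum>(f ` I) = (\<Sum>k=1..q. \<Sum>j<t - k. a (j + k) - a j)"
      unfolding sum.reindex[OF f_inj] by (simp add: I_def f_def sum.Sigma)
    also have "\<dots> \<le> (\<Sum>k=1..q. int U * int k)"
      by (rule sum_mono) (rule order)
    also have "\<dots> = int U * (\<Sum>k=1..q. int k)"
      by (simp add: sum_distrib_left)
    finally have "2 * \<Sum>(f ` I) \<le> int U * (2 * (\<Sum>k=1..q. int k))"
      by simp
    also have "2 * (\<Sum>k=1..q. int k) = int q * (int q + 1)"
      by (induction q) (auto simp: algebra_simps)
    finally show "2 * \<Sum>(f ` I) \<le> int (U * q * (q + 1))"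
      by (simp add: algebra_simps)
  qed
qed

lemma finite_pos_diffs: "finite A \<Longrightarrow> finite (pos_diffs A)"
  by (rule finite_subset[of _ "(\<lambda>(x, y). y - x) ` (A \<times> A)"]) (auto simp: pos_diffs_def)

text \<open>The sum is q t - q (q + 1) / 2; the bound q \<le> t keeps the natural subtraction from
  truncating.\<close>

lemma sum_orders:
  assumes "q \<le> t"
  shows "real (\<Sum>k=1..q. t - k) = real q * (real t - (real q + 1) / 2)"
  using assms by (induction q) (auto simp: field_simps of_nat_diff)

lemma ruler_packing_size_le:
  assumes "ruler_packing t U b A" "q \<in> {1..t - 1}"
  shows "real b * (real q / (real q + 1) * (real t - (real q + 1) / 2)\<^sup>2) \<le> real U"
proof (cases "b = 0")
  case False
  define N where "N = (\<Sum>k=1..q. t - k)"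
  have ruler: "golomb_ruler t (A i)" "pos_diffs (A i) \<subseteq> {1..int U}" if "i \<in> {1..b}" for i
    using assms(1) that by (auto simp: ruler_packing_def)
  have q: "0 < q" "q < t"
    using assms(2) by auto
  have "\<exists>D. D \<subseteq> pos_diffs (A i) \<and> card D = N \<and> 2 * \<Sum>D \<le> int (U * q * (q + 1))"
    if "i \<in> {1..b}" for i
    using golomb_ruler_small_order_differences[OF ruler[OF that] q(2)] unfolding N_def by metis
  then obtain D where D: "D i \<subseteq> pos_diffs (A i)" "card (D i) = N"
    "2 * \<Sum>(D i) \<le> int (U * q * (q + 1))" if "i \<in> {1..b}" for i
    by metis
  have fin: "finite (D i)" if "i \<in> {1..b}" for i
    using D(1)[OF that] finite_pos_diffs ruler(1)[OF that] finite_subset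
    by (auto simp: golomb_ruler_def)
  have disj: "D i \<inter> D j = {}" if "i \<in> {1..b}" "j \<in> {1..b}" "i \<noteq> j" for i j
    using assms(1) D(1)[OF that(1)] D(1)[OF that(2)] that
    unfolding ruler_packing_def disjoint_family_on_def by blast
  define S where "S = (\<Union>i\<in>{1..b}. D i)"
  have card: "card S = b * N"
    unfolding S_def using fin disj D(2) by (subst card_UN_disjoint) auto
  have "\<Sum>S = (\<Sum>i\<in>{1..b}. \<Sum>(D i))"
    unfolding S_def using fin disj by (subst sum.UNION_disjoint) auto
  then have "2 * \<Sum>S = (\<Sum>i\<in>{1..b}. 2 * \<Sum>(D i))"
    by (simp add: sum_distrib_left)
  also have "\<dots> \<le> (\<Sum>i\<in>{1..b}. int (U * q * (q + 1)))"
    by (rule sum_mono) (rule D(3))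
  finally have upper: "2 * \<Sum>S \<le> int (b * (U * q * (q + 1)))"
    by simp
  have "finite S"
    using fin by (auto simp: S_def)
  moreover have "x > 0" if "x \<in> S" for x
    using that D(1) ruler(2) by (fastforce simp: S_def)
  ultimately have "(int (b * N))\<^sup>2 \<le> 2 * \<Sum>S"
    using square_card_le_sum_pos_ints card by metis
  with upper have "int ((b * N)\<^sup>2) \<le> int (b * (U * q * (q + 1)))"
    by simp
  then have "(b * N)\<^sup>2 \<le> b * (U * q * (q + 1))"
    by (simp only: of_nat_le_iff)
  \<comment> \<open>The lower bound is quadratic in b and the upper one linear, so cancelling one
    factor b bounds the number of rulers.\<close>
  then have "b * (b * N\<^sup>2) \<le> b * (U * q * (q + 1))"
    by (simp only: power2_eq_square ac_simps)
  then have "b * N\<^sup>2 \<le> U * q * (q + 1)"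
    using False by (simp only: nat_mult_le_cancel1 neq0_conv)
  then have "real (b * N\<^sup>2) \<le> real (U * q * (q + 1))"
    by (simp only: of_nat_le_iff)
  then have "real b * (real N)\<^sup>2 \<le> real U * real q * (real q + 1)"
    by (simp add: algebra_simps)
  moreover have "real N = real q * (real t - (real q + 1) / 2)"
    unfolding N_def using q by (intro sum_orders) simp
  \<comment> \<open>N carries a factor q, so its square has one more q than the right-hand side;
    cancelling the common q leaves the weight q / (q + 1).\<close>
  ultimately have "real q * (real b * real q * (real t - (real q + 1) / 2)\<^sup>2)
      \<le> real q * (real U * (real q + 1))"
    by (simp add: power_mult_distrib power2_eq_square algebra_simps)
  then have "real b * real q * (real t - (real q + 1) / 2)\<^sup>2 \<le> real U * (real q + 1)"
    using q by simp
  then show ?thesis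
    by (simp add: field_simps)
qed simp

lemma A_S_pos:
  assumes "t \<ge> 2"
  shows "A_S t > 0"
proof -
  \<comment> \<open>The choice q = 1 contributes (t - 1)^2 / 2, which is positive, so dividing by
    \<open>A_S t\<close> is legitimate.\<close>
  have "0 < real 1 / (real 1 + 1) * (real t - (real 1 + 1) / 2)\<^sup>2"
    using assms by simp
  also have "\<dots> \<le> A_S t"
    unfolding A_S_def using assms by (intro Max_ge image_eqI[of _ _ 1]) auto
  finally show ?thesis .
qed

text \<open>The maximum over the finite nonempty range of q is attained, so the bound for a
  maximizing q applies.\<close>

lemma ruler_packing_size_le_A_S:
  assumes "ruler_packing t U b A" "t \<ge> 2"
  shows "real b * A_S t \<le> real U"
proof -
  have "A_S t \<in> (\<lambda>q. real q / (real q + 1) * (real t - (real q + 1) / 2)\<^sup>2) ` {1..t - 1}"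
    unfolding A_S_def using assms(2) by (intro Max_in) auto
  then show ?thesis
    using ruler_packing_size_le[OF assms(1)] by auto
qed

lemma max_coverage_proportion_le:
  assumes "t \<ge> 2"
  shows "real (max_coverage t U) / real U \<le> min 1 (real (t choose 2) / A_S t)"
proof -
  obtain b A where cov: "max_coverage t U = card (\<Union>i\<in>{1..b}. pos_diffs (A i))"
    and A: "ruler_packing t U b A"
    using Max_in[OF max_coverage_set] unfolding max_coverage_def by blast
  have "(\<Union>i\<in>{1..b}. pos_diffs (A i)) \<subseteq> {1..int U}"
    using A unfolding ruler_packing_def by blast
  from card_mono[OF _ this] have le_U: "max_coverage t U \<le> U"
    by (simp add: cov)
  have "max_coverage t U \<le> (\<Sum>i\<in>{1..b}. card (pos_diffs (A i)))"
    unfolding cov by (rule card_UN_le) simp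
  also have "\<dots> = b * (t choose 2)"
    using A by (simp add: ruler_packing_def golomb_ruler_iff_card)
  finally have "real (max_coverage t U) * A_S t \<le> real (b * (t choose 2)) * A_S t"
    using A_S_pos[OF assms] by (intro mult_right_mono) (auto simp del: of_nat_mult)
  also have "\<dots> = real (t choose 2) * (real b * A_S t)"
    by simp
  also have "\<dots> \<le> real (t choose 2) * real U"
    by (intro mult_left_mono ruler_packing_size_le_A_S[OF A assms]) simp
  finally have "real (max_coverage t U) * A_S t \<le> real (t choose 2) * real U" .
  \<comment> \<open>For U = 0 the quotient is 0 by convention, and the right side is
    nonnegative.\<close>
  with le_U A_S_pos[OF assms] show ?thesis
    by (cases "U = 0") (auto simp: field_simps)
qed

theorem theorem4p1:
  fixes t :: nat
  assumes "t \<ge> 3"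
  shows "limsup (\<lambda>U. ereal (real (max_coverage t U) / real U))
           \<le> ereal (min 1 (real (t choose 2) / A_S t))
       \<and> liminf (\<lambda>U. ereal (uncovered_proportion t U)) \<ge> ereal (c_S t)"
proof
  \<comment> \<open>The bound holds for each U with no error term, so it passes directly to the
    limits.\<close>
  have le: "real (max_coverage t U) / real U \<le> min 1 (real (t choose 2) / A_S t)" for U
    using assms by (intro max_coverage_proportion_le) simp
  then show "limsup (\<lambda>U. ereal (real (max_coverage t U) / real U))
      \<le> ereal (min 1 (real (t choose 2) / A_S t))"
    by (intro Limsup_bounded always_eventually allI) (simp only: ereal_less_eq)
  \<comment> \<open>This uses 1 - min 1 x = max 0 (1 - x).\<close>
  have "c_S t \<le> uncovered_proportion t U" for U
    using le[of U] by (simp add: c_S_def uncovered_proportion_def)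
  then show "liminf (\<lambda>U. ereal (uncovered_proportion t U)) \<ge> ereal (c_S t)"
    by (intro Liminf_bounded always_eventually allI) (simp only: ereal_less_eq)
qed

end
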